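(* Let $(m_n)_{n\ge 1}$ be a sequence of positive integers with $m_n\to\infty$ as $n\to\infty$. For each $n\ge 1$ let $X_n$ be a random variable with values in $\{1,\ldots,m_n\}$ and $\mathbb{P}(X_n=i)=p_n(i)>0$ for $i=1,\ldots,m_n$, let $X_{n,1},\ldots,X_{n,n}$ be iid random variables with the same distribution as $X_n$, and let $\chi_n^2$ be the associated Pearson chi-square statistic. Assume that $$\frac{1}{m_n n}\,\mathrm{Var}\!\left(\frac{1}{p_n(X_n)}\right)\to 0\qquad\text{and}\qquad \frac{n}{\sqrt{m_n}}\to\lambda\in(0,\infty)$$ as $n\to\infty$. Then, as $n\to\infty$, $$\frac{\chi_n^2-m_n}{\sqrt{2m_n}}\ \stackrel{d}{\to}\ \frac{\sqrt{2}}{\lambda}\,Z-\frac{\lambda}{\sqrt{2}},$$ where $Z$ is a Poisson random variable with mean $\lambda^2/2$.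
   Context: The Pearson chi-square statistic is $$\chi_n^2=n\sum_{i=1}^{m_n}\frac{(\hat p_n(i)-p_n(i))^2}{p_n(i)},\qquad \hat p_n(i)=\frac1n\sum_{k=1}^n I(X_{n,k}=i),\quad i=1,\ldots,m_n,$$ where $I(\cdot)$ denotes the indicator of an event. The random variable $1/p_n(X_n)$ is the function $i\mapsto 1/p_n(i)$ evaluated at $X_n$. The symbol $\stackrel{d}{\to}$ denotes convergence in distribution. *)

theory Defs
  imports "HOL-Probability.Probability"
begin

text \<open>
  A sample of size \<open>n\<close> is a function \<open>x\<close> of which only the values \<open>x 1, \<dots>, x n\<close> matter; the cells
  are \<open>1, \<dots>, m\<close>.
\<close>

definition empirical_freq :: "nat \<Rightarrow> (nat \<Rightarrow> nat) \<Rightarrow> nat \<Rightarrow> real" where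
  "empirical_freq n x i = 1 / real n * (\<Sum>k=1..n. of_bool (x k = i))"

definition pearson_chi_square :: "nat \<Rightarrow> nat \<Rightarrow> (nat \<Rightarrow> real) \<Rightarrow> (nat \<Rightarrow> nat) \<Rightarrow> real" where
  "pearson_chi_square n m p x = real n * (\<Sum>i=1..m. (empirical_freq n x i - p i)\<^sup>2 / p i)"

end

theory Submission
  imports Defs
begin

text \<open>
  Put \<open>W(i) = 1 / (m p(i))\<close>. Expanding the squares, \<open>(\<chi>\<^sup>2 - m) / sqrt (2 m)\<close> equals
  \<open>a \<Sum>\<^sub>k (W(X\<^sub>k) - 1) + c Y - d\<close> with \<open>Y = \<Sum>\<^sub>j\<^sub><\<^sub>k I(X\<^sub>j = X\<^sub>k) W(X\<^sub>k)\<close> and deterministic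
  \<open>a, c, d\<close> such that \<open>c \<rightarrow> sqrt 2 / \<lambda>\<close> and \<open>d \<rightarrow> \<lambda> / sqrt 2\<close>. The variance hypothesis says that the
  first term tends to \<open>0\<close> in \<open>L\<^sup>2\<close>, equivalently that \<open>n Var W(X) \<rightarrow> 0\<close>. Since \<open>p(i) W(i) = 1 / m\<close>, the
  expected increment of \<open>Y\<close> at step \<open>k + 1\<close> is the number \<open>k / m\<close> whatever the past, and up to small errors
  the increments are \<open>0\<close> or \<open>1\<close>. Hence the characteristic function \<open>\<phi>\<^sub>k\<close> of \<open>Y\<close> after \<open>k\<close> steps almost
  satisfies \<open>\<phi>\<^sub>k\<^sub>+\<^sub>1(t) = exp (k / m (e\<^sup>i\<^sup>t - 1)) \<phi>\<^sub>k(t)\<close>, and \<open>\<phi>\<^sub>n\<close> is close to the characteristic function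
  of a Poisson variable with mean \<open>n (n - 1) / (2 m) \<rightarrow> \<lambda>\<^sup>2 / 2\<close>. Levy's continuity theorem concludes.
\<close>

subsection \<open>Coincidences in a sample\<close>

definition occurrences :: "nat \<Rightarrow> (nat \<Rightarrow> 'a) \<Rightarrow> 'a \<Rightarrow> real" where
  "occurrences k x i = (\<Sum>j=1..k. of_bool (x j = i))"

lemma occurrences_0 [simp]: "occurrences 0 x i = 0"
  by (simp add: occurrences_def)

lemma occurrences_Suc: "occurrences (Suc k) x i = occurrences k x i + of_bool (x (Suc k) = i)"
  by (simp add: occurrences_def)

lemma occurrences_cong:
  "(\<And>j. j \<in> {1..k} \<Longrightarrow> x j = y j) \<Longrightarrow> occurrences k x i = occurrences k y i"
  unfolding occurrences_def by (intro sum.cong) auto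

lemma occurrences_upd_Suc [simp]: "occurrences k (x(Suc k := a)) i = occurrences k x i"
  by (rule occurrences_cong) simp

text \<open>Counts are integers although their type is \<open>real\<close>; this dichotomy is the
  form of integrality that \<open>norm_iexp_linearization_le\<close> takes as hypothesis.\<close>

lemma occurrences_cases: "occurrences k x i = 0 \<or> occurrences k x i \<ge> 1"
  by (induction k) (auto simp: occurrences_Suc)

lemma sum_occurrences:
  assumes "finite A" "\<And>j. j \<in> {1..k} \<Longrightarrow> x j \<in> A"
  shows "(\<Sum>i\<in>A. occurrences k x i) = real k"
  using assms(2)
  by (induction k) (auto simp: occurrences_Suc sum.distrib of_bool_def assms(1))

text \<open>Pairs j < l in the same cell are grouped by their later index l, whence
  \<open>l - 1\<close>. Appending an observation then adds a single summand and leaves the others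
  alone.\<close>

definition weighted_coincidences :: "('a \<Rightarrow> real) \<Rightarrow> nat \<Rightarrow> (nat \<Rightarrow> 'a) \<Rightarrow> real" where
  "weighted_coincidences w k x = (\<Sum>l=1..k. occurrences (l - 1) x (x l) * w (x l))"

lemma weighted_coincidences_0 [simp]: "weighted_coincidences w 0 x = 0"
  by (simp add: weighted_coincidences_def)

lemma weighted_coincidences_Suc:
  "weighted_coincidences w (Suc k) x
    = weighted_coincidences w k x + occurrences k x (x (Suc k)) * w (x (Suc k))"
  by (simp add: weighted_coincidences_def)

lemma weighted_coincidences_cong:
  assumes "\<And>j. j \<in> {1..k} \<Longrightarrow> x j = y j"
  shows "weighted_coincidences w k x = weighted_coincidences w k y"
  unfolding weighted_coincidences_def
proof (rule sum.cong)
  fix l assume l: "l \<in> {1..k}"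
  then have "occurrences (l - 1) x i = occurrences (l - 1) y i" for i
    by (intro occurrences_cong assms) auto
  with assms[OF l] show "occurrences (l - 1) x (x l) * w (x l) = occurrences (l - 1) y (y l) * w (y l)"
    by simp
qed simp

lemma weighted_coincidences_upd_Suc [simp]:
  "weighted_coincidences w k (x(Suc k := a)) = weighted_coincidences w k x"
  by (rule weighted_coincidences_cong) simp

text \<open>Squaring the counts enumerates ordered pairs of indices in the same cell: the diagonal
  yields the plain sum of \<open>w\<close>, and every pair j < l appears twice.\<close>

lemma sum_occurrences_square:
  assumes "finite A" "\<And>j. j \<in> {1..k} \<Longrightarrow> x j \<in> A"
  shows "(\<Sum>i\<in>A. (occurrences k x i)\<^sup>2 * w i)
    = (\<Sum>l=1..k. w (x l)) + 2 * weighted_coincidences w k x"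
  using assms(2)
proof (induction k)
  case (Suc k)
  \<comment> \<open>Only the cell hit by the new observation changes, and (N + 1)^2 - N^2 = 2 N +
    1.\<close>
  have "(\<Sum>i\<in>A. (occurrences (Suc k) x i)\<^sup>2 * w i)
    = (\<Sum>i\<in>A. (occurrences k x i)\<^sup>2 * w i
        + (if x (Suc k) = i then (2 * occurrences k x i + 1) * w i else 0))"
    by (intro sum.cong) (auto simp: occurrences_Suc power2_eq_square algebra_simps)
  also have "\<dots> = (\<Sum>i\<in>A. (occurrences k x i)\<^sup>2 * w i)
        + (2 * occurrences k x (x (Suc k)) + 1) * w (x (Suc k))"
    using Suc.prems assms(1) by (simp add: sum.distrib)
  finally show ?case
    using Suc by (simp add: weighted_coincidences_Suc algebra_simps)
qed (auto simp: weighted_coincidences_def)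

text \<open>Since 1 / p(i) = m w(i), expanding the squares leaves the weighted squared counts, while
  the remaining terms see the sample only through the total count n. Subtracting m centres each
  \<open>w (x k)\<close> at 1, its mean under p.\<close>

lemma pearson_chi_square_decomposition:
  assumes n: "n \<ge> 1" and m: "m \<ge> 1" and p: "\<And>i. i \<in> {1..m} \<Longrightarrow> p i > 0" "(\<Sum>i=1..m. p i) = 1"
    and x: "\<And>k. k \<in> {1..n} \<Longrightarrow> x k \<in> {1..m}"
  defines "w \<equiv> \<lambda>i. 1 / (real m * p i)"
  shows "(pearson_chi_square n m p x - real m) / sqrt (2 * real m)
    = sqrt (real m) / (sqrt 2 * real n) * (\<Sum>k=1..n. w (x k) - 1)
      + sqrt 2 * sqrt (real m) / real n * weighted_coincidences w n x
      - real n / sqrt (2 * real m)"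
proof -
  have cell: "(empirical_freq n x i - p i)\<^sup>2 / p i
    = real m / (real n)\<^sup>2 * ((occurrences n x i)\<^sup>2 * w i) - 2 / real n * occurrences n x i + p i"
    if "i \<in> {1..m}" for i
    using p(1)[OF that] n m
    unfolding empirical_freq_def occurrences_def[symmetric] w_def
    by (simp add: field_simps power2_eq_square)
  have sums: "(\<Sum>i=1..m. occurrences n x i) = real n"
    "(\<Sum>i=1..m. (occurrences n x i)\<^sup>2 * w i) = (\<Sum>k=1..n. w (x k)) + 2 * weighted_coincidences w n x"
    by (intro sum_occurrences sum_occurrences_square; use x in simp)+
  have "pearson_chi_square n m p x
    = real n * (\<Sum>i=1..m. real m / (real n)\<^sup>2 * ((occurrences n x i)\<^sup>2 * w i)
        - 2 / real n * occurrences n x i + p i)"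
    unfolding pearson_chi_square_def using cell by simp
  also have "\<dots> = real n * (real m / (real n)\<^sup>2 * (\<Sum>i=1..m. (occurrences n x i)\<^sup>2 * w i)
        - 2 / real n * (\<Sum>i=1..m. occurrences n x i) + (\<Sum>i=1..m. p i))"
    by (simp add: sum.distrib sum_subtractf sum_distrib_left)
  also have "\<dots> = real m / real n * ((\<Sum>k=1..n. w (x k)) + 2 * weighted_coincidences w n x) - real n"
    unfolding sums p(2) using n by (simp add: field_simps power2_eq_square)
  finally have chi: "pearson_chi_square n m p x
    = real m / real n * ((\<Sum>k=1..n. w (x k)) + 2 * weighted_coincidences w n x) - real n" .
  \<comment> \<open>With the square roots as atoms and m = s * s, 2 = q * q, the claim becomes a
    rational identity.\<close>
  define s where "s = sqrt (real m)"
  have s: "real m = s * s" "s > 0" using m by (auto simp: s_def)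
  define q where "q = sqrt (2::real)"
  have q: "q > 0" by (simp add: q_def)
  have two: "2 * y = q * q * y" for y by (simp add: q_def)
  show ?thesis
    unfolding chi real_sqrt_mult s_def[symmetric] q_def[symmetric] unfolding s(1) two
    using s(2) n q by (simp add: sum_subtractf field_simps)
qed

subsection \<open>Exponential estimates\<close>

text \<open>This is the first order Taylor remainder. It pays for replacing the linearised increment
  factor 1 + z by exp z in the recursion for the characteristic function.\<close>

lemma norm_exp_minus_linear_le:
  fixes z :: complex
  shows "norm (1 + z - exp z) \<le> exp (norm z) * (norm z)\<^sup>2"
proof -
  have "norm (1 + z - exp z) = norm (exp z - (\<Sum>k\<le>1. z ^ k / fact k))"
    by (simp add: norm_minus_commute)
  then show ?thesis
    using Taylor_exp_field[of z 1] by (simp add: power2_eq_square)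
qed

lemma norm_iexp_diff_le: "norm (iexp a - iexp b) \<le> \<bar>a - b\<bar>"
proof -
  have "iexp a - iexp b = iexp b * (iexp (a - b) - 1)"
    by (simp add: algebra_simps exp_diff)
  then show ?thesis
    using iexp_approx1[of "a - b" 0] by (simp add: norm_mult)
qed

lemma norm_iexp_minus_1_le: "norm (iexp t - 1) \<le> \<bar>t\<bar>" "norm (iexp t - 1) \<le> 2"
  using norm_iexp_diff_le[of t 0] norm_triangle_ineq4[of "iexp t" 1] by auto

text \<open>For w = 1 and c = 0 or c = 1 both sides vanish. In general w is first replaced by 1 in
  the exponent and in the linear term, each at cost |t| c |w - 1|; the excess of c over 1 then costs
  2 |t| c (c - 1).\<close>

lemma norm_iexp_linearization_le:
  assumes "c = 0 \<or> c \<ge> (1::real)"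
  shows "norm (iexp (t * (c * w)) - 1 - of_real (c * w) * (iexp t - 1))
    \<le> 2 * \<bar>t\<bar> * (c * \<bar>w - 1\<bar> + c * (c - 1))"
proof -
  have c: "c \<ge> 0" using assms by auto
  have 1: "norm (iexp (t * (c * w)) - iexp (t * c)) \<le> \<bar>t\<bar> * (c * \<bar>w - 1\<bar>)"
    using norm_iexp_diff_le[of "t * (c * w)" "t * c"] c
    by (simp add: right_diff_distrib[symmetric] abs_mult) (metis abs_mult abs_of_nonneg mult.right_neutral right_diff_distrib)
  have 2: "norm (of_real (c - c * w) * (iexp t - 1)) \<le> (c * \<bar>w - 1\<bar>) * \<bar>t\<bar>"
  proof -
    have "norm (of_real (c - c * w) :: complex) = c * \<bar>w - 1\<bar>"
      unfolding norm_of_real using c by (metis abs_minus_commute abs_mult abs_of_nonneg mult.right_neutral right_diff_distrib)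
    then show ?thesis unfolding norm_mult
      by (metis c abs_ge_zero mult_left_mono mult_nonneg_nonneg norm_iexp_minus_1_le(1))
  qed
  have 3: "norm (iexp (t * c) - 1 - of_real c * (iexp t - 1)) \<le> 2 * \<bar>t\<bar> * (c * (c - 1))"
  proof (cases "c = 0")
    case False
    with assms have c1: "c \<ge> 1" by simp
    have "iexp (t * c) - 1 - of_real c * (iexp t - 1) = (iexp (t * c) - iexp t) - of_real (c - 1) * (iexp t - 1)"
      by (simp add: algebra_simps)
    also have "norm \<dots> \<le> \<bar>t * c - t\<bar> + (c - 1) * \<bar>t\<bar>"
    proof (rule norm_triangle_le_diff, rule add_mono)
      show "norm (of_real (c - 1) * (iexp t - 1)) \<le> (c - 1) * \<bar>t\<bar>"
        unfolding norm_mult norm_of_real using c1 norm_iexp_minus_1_le(1)[of t]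
        by (intro mult_mono) auto
    qed (rule norm_iexp_diff_le)
    also have "\<bar>t * c - t\<bar> = \<bar>t\<bar> * (c - 1)"
      using c1 by (metis abs_mult abs_of_nonneg diff_ge_0_iff_ge mult.right_neutral right_diff_distrib)
    \<comment> \<open>The factor c - 1 is weakened to c (c - 1), which is also right at c = 0 and
      whose expectation is a factorial moment.\<close>
    also have "\<bar>t\<bar> * (c - 1) + (c - 1) * \<bar>t\<bar> \<le> 2 * \<bar>t\<bar> * (c * (c - 1))"
      using mult_left_mono[of "c - 1" "c * (c - 1)" "2 * \<bar>t\<bar>"] mult_right_mono[of 1 c "c - 1"] c1
      by simp
    finally show ?thesis .
  qed simp
  have "iexp (t * (c * w)) - 1 - of_real (c * w) * (iexp t - 1)
    = (iexp (t * (c * w)) - iexp (t * c)) + of_real (c - c * w) * (iexp t - 1)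
      + (iexp (t * c) - 1 - of_real c * (iexp t - 1))"
    by (simp add: algebra_simps)
  also have "norm \<dots> \<le> \<bar>t\<bar> * (c * \<bar>w - 1\<bar>) + (c * \<bar>w - 1\<bar>) * \<bar>t\<bar> + 2 * \<bar>t\<bar> * (c * (c - 1))"
    by (intro norm_triangle_mono 1 2 3)
  finally show ?thesis by (simp add: algebra_simps)
qed

subsection \<open>Sampling from a finite distribution\<close>

locale finite_sampling =
  fixes A :: "'a set" and p :: "'a \<Rightarrow> real"
  assumes finite_A [simp]: "finite A"
    and p_pos: "\<And>i. i \<in> A \<Longrightarrow> p i > 0"
    and sum_p: "(\<Sum>i\<in>A. p i) = 1"
begin

text \<open>Expectation over k independent draws as a finite sum. Extensional functions represent
  each sample exactly once; the vector-valued codomain covers both real moments and characteristic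
  functions.\<close>

definition expect :: "nat \<Rightarrow> ((nat \<Rightarrow> 'a) \<Rightarrow> 'b::real_normed_vector) \<Rightarrow> 'b" where
  "expect k g = (\<Sum>x\<in>{1..k} \<rightarrow>\<^sub>E A. (\<Prod>j=1..k. p (x j)) *\<^sub>R g x)"

lemma p_nonneg: "i \<in> A \<Longrightarrow> p i \<ge> 0"
  using p_pos by (simp add: less_imp_le)

lemma prod_p_nonneg: "x \<in> {1..k} \<rightarrow>\<^sub>E A \<Longrightarrow> (\<Prod>j=1..k. p (x j)) \<ge> 0"
  by (intro prod_nonneg p_nonneg) auto

lemma finite_samples [simp]: "finite ({1..k} \<rightarrow>\<^sub>E A)" for k :: nat
  by (intro finite_PiE) auto

lemma expect_0 [simp]: "expect 0 g = g (\<lambda>_. undefined)"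
  by (simp add: expect_def)

text \<open>Conditioning on the first k observations: the inner sum integrates out the last one. The
  exact moments and the recursion for the characteristic function rest on it.\<close>

lemma expect_Suc: "expect (Suc k) g = expect k (\<lambda>x. \<Sum>i\<in>A. p i *\<^sub>R g (x(Suc k := i)))"
proof -
  have "{1..Suc k} \<rightarrow>\<^sub>E A = (\<lambda>(i, x). x(Suc k := i)) ` (A \<times> ({1..k} \<rightarrow>\<^sub>E A))"
    using PiE_insert_eq[of "Suc k" "{1..k}" "\<lambda>_. A"] by (simp add: atLeastAtMostSuc_conv)
  then have "expect (Suc k) g
    = (\<Sum>(i, x)\<in>A \<times> ({1..k} \<rightarrow>\<^sub>E A). (\<Prod>j=1..Suc k. p ((x(Suc k := i)) j)) *\<^sub>R g (x(Suc k := i)))"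
    unfolding expect_def
    by (simp only:, subst sum.reindex[OF inj_combinator]) (simp_all add: case_prod_unfold)
  also have "\<dots> = (\<Sum>(i, x)\<in>A \<times> ({1..k} \<rightarrow>\<^sub>E A). ((\<Prod>j=1..k. p (x j)) * p i) *\<^sub>R g (x(Suc k := i)))"
    by (intro sum.cong) (auto intro!: prod.cong)
  also have "\<dots> = expect k (\<lambda>x. \<Sum>i\<in>A. p i *\<^sub>R g (x(Suc k := i)))"
    unfolding expect_def
    by (subst sum.cartesian_product[symmetric], subst sum.swap) (simp add: scaleR_sum_right)
  finally show ?thesis .
qed

lemma expect_cong:
  "(\<And>x. x \<in> {1..k} \<rightarrow>\<^sub>E A \<Longrightarrow> f x = g x) \<Longrightarrow> expect k f = expect k g"
  unfolding expect_def by (intro sum.cong) auto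

lemma expect_add: "expect k (\<lambda>x. f x + g x) = expect k f + expect k g"
  by (simp add: expect_def scaleR_add_right sum.distrib)

lemma expect_diff: "expect k (\<lambda>x. f x - g x) = expect k f - expect k g"
  by (simp add: expect_def scaleR_diff_right sum_subtractf)

lemma expect_mult_left:
  fixes c :: "'b::real_normed_algebra"
  shows "expect k (\<lambda>x. c * f x) = c * expect k f"
  by (simp add: expect_def sum_distrib_left)

lemma expect_sum: "expect k (\<lambda>x. \<Sum>i\<in>I. f i x) = (\<Sum>i\<in>I. expect k (f i))"
  unfolding expect_def by (simp add: scaleR_sum_right) (rule sum.swap)

lemma expect_const: "expect k (\<lambda>_. c) = c"
  by (induction k) (simp_all add: expect_Suc flip: scaleR_sum_left, simp add: sum_p)

lemma expect_mono:
  fixes f g :: "(nat \<Rightarrow> 'a) \<Rightarrow> real"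
  assumes "\<And>x. x \<in> {1..k} \<rightarrow>\<^sub>E A \<Longrightarrow> f x \<le> g x"
  shows "expect k f \<le> expect k g"
  unfolding expect_def real_scaleR_def
  by (intro sum_mono mult_left_mono assms prod_p_nonneg)

lemma norm_expect_le: "norm (expect k g) \<le> expect k (\<lambda>x. norm (g x))"
  unfolding expect_def norm_scaleR real_scaleR_def
  by (intro sum_norm_le) (simp only: norm_scaleR abs_of_nonneg[OF prod_p_nonneg] order_refl)

text \<open>Cauchy-Schwarz, obtained from the nonnegativity of the variance of |f|.\<close>

lemma expect_abs_le:
  fixes f :: "(nat \<Rightarrow> 'a) \<Rightarrow> real"
  shows "expect k (\<lambda>x. \<bar>f x\<bar>) \<le> sqrt (expect k (\<lambda>x. (f x)\<^sup>2))"
proof -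
  define a where "a = expect k (\<lambda>x. \<bar>f x\<bar>)"
  have "0 \<le> expect k (\<lambda>x. (\<bar>f x\<bar> - a)\<^sup>2)"
    using expect_mono[of k "\<lambda>_. 0" "\<lambda>x. (\<bar>f x\<bar> - a)\<^sup>2"] by (simp add: expect_const)
  also have "(\<lambda>x. (\<bar>f x\<bar> - a)\<^sup>2) = (\<lambda>x. (f x)\<^sup>2 - (2 * a) * \<bar>f x\<bar> + a\<^sup>2)"
    by (auto simp: power2_eq_square algebra_simps)
  also have "expect k \<dots> = expect k (\<lambda>x. (f x)\<^sup>2) - a\<^sup>2"
    unfolding expect_add expect_diff expect_mult_left expect_const a_def[symmetric]
    by (simp add: power2_eq_square)
  finally show ?thesis
    unfolding a_def[symmetric] by (intro real_le_rsqrt) simp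
qed

section \<open>Moments of counts and of centred sums\<close>

lemma expect_occurrences: "i \<in> A \<Longrightarrow> expect k (\<lambda>x. occurrences k x i) = real k * p i"
proof (induction k)
  case (Suc k)
  have "(\<Sum>a\<in>A. p a *\<^sub>R occurrences (Suc k) (x(Suc k := a)) i) = occurrences k x i + p i" for x
    using Suc.prems
    by (simp add: occurrences_Suc ring_distribs sum.distrib sum_p of_bool_def if_distrib[of "\<lambda>u. _ * u"] flip: sum_distrib_right cong: if_cong)
  with Suc show ?case
    by (simp add: expect_Suc expect_add expect_const algebra_simps)
qed simp

text \<open>The second factorial moment of a binomial count. A hit raises N (N - 1) by 2 N and has
  probability p(i), so the increments 2 j p(i)^2 for j < k add up.\<close>

lemma expect_occurrences_pairs:
  "i \<in> A \<Longrightarrow> expect k (\<lambda>x. occurrences k x i * (occurrences k x i - 1)) = real k * (real k - 1) * (p i)\<^sup>2"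
proof (induction k)
  case (Suc k)
  have "(\<Sum>a\<in>A. p a *\<^sub>R (occurrences (Suc k) (x(Suc k := a)) i * (occurrences (Suc k) (x(Suc k := a)) i - 1)))
    = occurrences k x i * (occurrences k x i - 1) + (2 * p i) * occurrences k x i" for x
  proof -
    have "(\<Sum>a\<in>A. p a *\<^sub>R (occurrences (Suc k) (x(Suc k := a)) i * (occurrences (Suc k) (x(Suc k := a)) i - 1)))
      = (\<Sum>a\<in>A. p a * (occurrences k x i * (occurrences k x i - 1)) 
          + (if a = i then p a * (2 * occurrences k x i) else 0))"
      by (intro sum.cong) (auto simp: occurrences_Suc algebra_simps)
    then show ?thesis
      using Suc.prems by (simp add: sum.distrib sum_p flip: sum_distrib_right)
  qed
  then show ?case
    unfolding expect_Suc expect_add expect_mult_left Suc.IH[OF Suc.prems] expect_occurrences[OF Suc.prems]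
    by (simp only: expect_add expect_mult_left Suc.IH[OF Suc.prems] expect_occurrences[OF Suc.prems])
       (simp add: algebra_simps power2_eq_square)
qed simp

text \<open>Independence and centring kill the cross term at each step, so only variances
  accumulate.\<close>

lemma expect_sum_square:
  assumes "(\<Sum>i\<in>A. p i * d i) = 0"
  shows "expect k (\<lambda>x. (\<Sum>j=1..k. d (x j))\<^sup>2) = real k * (\<Sum>i\<in>A. p i * (d i)\<^sup>2)"
proof (induction k)
  case (Suc k)
  have "(\<Sum>i\<in>A. p i *\<^sub>R (\<Sum>j=1..Suc k. d ((x(Suc k := i)) j))\<^sup>2)
    = (\<Sum>j=1..k. d (x j))\<^sup>2 + (\<Sum>i\<in>A. p i * (d i)\<^sup>2)" for x
  proof -
    define s where "s = (\<Sum>j=1..k. d (x j))"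
    have s: "(\<Sum>j=1..Suc k. d ((x(Suc k := i)) j)) = s + d i" for i
      unfolding s_def by (auto intro!: sum.cong)
    have "(\<Sum>i\<in>A. p i *\<^sub>R (s + d i)\<^sup>2) = (\<Sum>i\<in>A. p i) * s\<^sup>2 + 2 * s * (\<Sum>i\<in>A. p i * d i) + (\<Sum>i\<in>A. p i * (d i)\<^sup>2)"
      by (simp add: sum_distrib_left sum_distrib_right flip: sum.distrib) (simp add: power2_eq_square algebra_simps)
    then show ?thesis unfolding s by (simp add: assms sum_p s_def)
  qed
  with Suc show ?case
    by (simp only: expect_Suc expect_add expect_const) (simp add: algebra_simps)
qed simp

section \<open>Weights normalised to mean one\<close>

definition weight :: "'a \<Rightarrow> real" where
  "weight i = 1 / (real (card A) * p i)"

text \<open>\<open>weight\<close> has mean 1 by \<open>sum_p_weight\<close>, so this is its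
  variance; it equals the variance of 1 / p(X) divided by the square of
  \<open>card A\<close>.\<close>

definition weight_variance :: real where
  "weight_variance = (\<Sum>i\<in>A. p i * (weight i - 1)\<^sup>2)"

lemma card_A_pos: "real (card A) > 0"
proof -
  have "A \<noteq> {}" using sum_p by auto
  then show ?thesis by (simp add: card_gt_0_iff)
qed

lemma p_weight: "i \<in> A \<Longrightarrow> p i * weight i = 1 / real (card A)"
  using p_pos[of i] by (simp add: weight_def)

lemma weight_pos: "i \<in> A \<Longrightarrow> weight i > 0"
  unfolding weight_def using p_pos by (intro divide_pos_pos mult_pos_pos card_A_pos) auto

lemma sum_p_weight: "(\<Sum>i\<in>A. p i * weight i) = 1"
  using card_A_pos by (auto simp: p_weight)

lemma weight_variance_nonneg: "weight_variance \<ge> 0"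
  unfolding weight_variance_def by (intro sum_nonneg) (simp add: p_nonneg)

lemma expect_sum_weight_square:
  "expect k (\<lambda>x. (\<Sum>j=1..k. weight (x j) - 1)\<^sup>2) = real k * weight_variance"
  unfolding weight_variance_def
  by (rule expect_sum_square) (simp add: right_diff_distrib sum_subtractf sum_p sum_p_weight)

section \<open>Recursion for the characteristic function of the weighted coincidences\<close>

definition char_coincidences :: "nat \<Rightarrow> real \<Rightarrow> complex" where
  "char_coincidences k t = expect k (\<lambda>x. iexp (t * weighted_coincidences weight k x))"

text \<open>The probability that three independent draws share a cell. It controls increments
  stemming from cells already hit at least twice.\<close>

definition cubic_error :: real where
  "cubic_error = (\<Sum>i\<in>A. (p i) ^ 3)"

text \<open>The mean of |W - 1| over the event that two draws coincide: the price of treating an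
  increment W as 1.\<close>

definition quadratic_error :: real where
  "quadratic_error = (\<Sum>i\<in>A. (p i)\<^sup>2 * \<bar>weight i - 1\<bar>)"

text \<open>Given the first k observations, the factor contributed by the next one has linearisation
  1 + z, where z does not depend on the sample. Averaging the linearisation error yields
  \<open>quadratic_error\<close> and \<open>cubic_error\<close>; passing from 1 + z to exp z yields
  \<open>?R\<close>.\<close>

lemma char_coincidences_step:
  fixes t :: real and k :: nat
  defines "z \<equiv> of_real (real k / real (card A)) * (iexp t - 1)"
  shows "norm (char_coincidences (Suc k) t - exp z * char_coincidences k t)
    \<le> 2 * \<bar>t\<bar> * (real k * quadratic_error + (real k)\<^sup>2 * cubic_error)
      + exp (2 * (real k / real (card A))) * (2 * (real k / real (card A)))\<^sup>2"
    (is "_ \<le> _ + ?R")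
proof -
  let ?N = "\<lambda>x i. occurrences k x i"
  have z: "norm z \<le> 2 * (real k / real (card A))"
    unfolding z_def norm_mult norm_of_real using mult_left_mono[OF norm_iexp_minus_1_le(2)[of t], of "real k / real (card A)"]
    by (simp add: mult.commute)
  have R: "norm (1 + z - exp z) \<le> ?R"
    by (rule order_trans[OF norm_exp_minus_linear_le]) (use z in \<open>intro mult_mono power_mono; simp\<close>)
  \<comment> \<open>The bound is linear in N and N (N - 1), the two quantities whose expectations
    are known exactly.\<close>
  have bound: "norm ((\<Sum>i\<in>A. p i *\<^sub>R iexp (t * (?N x i * weight i))) - exp z)
    \<le> (\<Sum>i\<in>A. (2 * \<bar>t\<bar> * p i * \<bar>weight i - 1\<bar>) * ?N x i + (2 * \<bar>t\<bar> * p i) * (?N x i * (?N x i - 1))) + ?R"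
    if x: "x \<in> {1..k} \<rightarrow>\<^sub>E A" for x
  proof -
    \<comment> \<open>The weights cancel the cell probabilities, and the counts add up to k whatever
      the sample.\<close>
    have "(\<Sum>i\<in>A. p i * (?N x i * weight i)) = (\<Sum>i\<in>A. ?N x i) / real (card A)"
      by (simp add: sum_divide_distrib) (intro sum.cong, simp_all add: p_weight mult.left_commute[of "p _"])
    also have "\<dots> = real k / real (card A)"
      using x by (subst sum_occurrences) auto
    finally have drift: "(\<Sum>i\<in>A. of_real (p i) * of_real (?N x i * weight i) * (iexp t - 1)) = z"
      unfolding z_def by (simp flip: sum_distrib_right of_real_mult of_real_sum)
    have one: "(\<Sum>i\<in>A. complex_of_real (p i)) = 1"
      by (simp add: sum_p flip: of_real_sum)
    have "(\<Sum>i\<in>A. p i *\<^sub>R iexp (t * (?N x i * weight i))) - exp z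
      = (\<Sum>i\<in>A. p i *\<^sub>R (iexp (t * (?N x i * weight i)) - 1 - of_real (?N x i * weight i) * (iexp t - 1)))
        + (1 + z - exp z)"
    proof -
      have "p i *\<^sub>R (iexp (t * (?N x i * weight i)) - 1 - of_real (?N x i * weight i) * (iexp t - 1))
        = p i *\<^sub>R iexp (t * (?N x i * weight i)) - of_real (p i)
          - of_real (p i) * of_real (?N x i * weight i) * (iexp t - 1)" for i
        by (simp only: scaleR_conv_of_real right_diff_distrib mult_1_right mult.assoc)
      then show ?thesis by (simp only: sum_subtractf one drift) simp
    qed
    also have "norm \<dots> \<le> (\<Sum>i\<in>A. p i * (2 * \<bar>t\<bar> * (?N x i * \<bar>weight i - 1\<bar> + ?N x i * (?N x i - 1)))) + ?R"
    proof (intro norm_triangle_mono R sum_norm_le)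
      fix i assume "i \<in> A"
      then show "norm (p i *\<^sub>R (iexp (t * (?N x i * weight i)) - 1 - of_real (?N x i * weight i) * (iexp t - 1)))
        \<le> p i * (2 * \<bar>t\<bar> * (?N x i * \<bar>weight i - 1\<bar> + ?N x i * (?N x i - 1)))"
        using norm_iexp_linearization_le[OF occurrences_cases[of k x i], of t "weight i"] p_nonneg[of i]
        by (simp add: abs_of_nonneg mult_left_mono)
    qed
    finally show ?thesis
      by (simp add: algebra_simps)
  qed
  have "char_coincidences (Suc k) t
    = expect k (\<lambda>x. iexp (t * weighted_coincidences weight k x) * (\<Sum>i\<in>A. p i *\<^sub>R iexp (t * (?N x i * weight i))))"
    unfolding char_coincidences_def expect_Suc
    by (simp add: weighted_coincidences_Suc ring_distribs exp_add sum_distrib_left)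
  then have "char_coincidences (Suc k) t - exp z * char_coincidences k t
    = expect k (\<lambda>x. iexp (t * weighted_coincidences weight k x) * (\<Sum>i\<in>A. p i *\<^sub>R iexp (t * (?N x i * weight i))))
      - expect k (\<lambda>x. exp z * iexp (t * weighted_coincidences weight k x))"
    by (simp only: char_coincidences_def[of k] expect_mult_left)
  also have "\<dots> = expect k (\<lambda>x. iexp (t * weighted_coincidences weight k x)
        * ((\<Sum>i\<in>A. p i *\<^sub>R iexp (t * (?N x i * weight i))) - exp z))"
    by (simp only: expect_diff[symmetric] right_diff_distrib mult.commute[of "exp z"])
  also have "norm \<dots> \<le> expect k (\<lambda>x. norm (iexp (t * weighted_coincidences weight k x)
        * ((\<Sum>i\<in>A. p i *\<^sub>R iexp (t * (?N x i * weight i))) - exp z)))"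
    by (rule norm_expect_le)
  \<comment> \<open>The phase carrying the past has modulus 1 and drops out.\<close>
  also have "\<dots> \<le> expect k (\<lambda>x. (\<Sum>i\<in>A. (2 * \<bar>t\<bar> * p i * \<bar>weight i - 1\<bar>) * ?N x i
      + (2 * \<bar>t\<bar> * p i) * (?N x i * (?N x i - 1))) + ?R)"
    by (intro expect_mono) (simp only: norm_mult norm_exp_i_times mult_1_left bound)
  also have "\<dots> = (\<Sum>i\<in>A. (2 * \<bar>t\<bar> * p i * \<bar>weight i - 1\<bar>) * (real k * p i)
      + (2 * \<bar>t\<bar> * p i) * (real k * (real k - 1) * (p i)\<^sup>2)) + ?R"
    unfolding expect_add expect_sum expect_mult_left expect_const
    by (simp add: expect_occurrences expect_occurrences_pairs)
  also have "\<dots> = 2 * \<bar>t\<bar> * (real k * quadratic_error + real k * (real k - 1) * cubic_error) + ?R"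
    by (simp add: quadratic_error_def cubic_error_def sum_distrib_left sum.distrib[symmetric] power2_eq_square power3_eq_cube algebra_simps)
  also have "\<dots> \<le> 2 * \<bar>t\<bar> * (real k * quadratic_error + (real k)\<^sup>2 * cubic_error) + ?R"
    by (intro add_mono mult_left_mono mult_right_mono)
       (auto simp: power2_eq_square cubic_error_def p_nonneg intro!: sum_nonneg mult_left_mono)
  finally show ?thesis .
qed

text \<open>The one-step exponents j / card A for j < k add up to k (k - 1) / (2 card A). Each
  multiplier exp z has modulus at most 1, so earlier errors are not amplified and at most k one-step
  errors accumulate. The separate n keeps the one-step bound constant along the induction on
  k.\<close>

lemma char_coincidences_bound:
  fixes t :: real and n k :: nat
  assumes "k \<le> n"
  shows "norm (char_coincidences k t - exp (of_real (real k * (real k - 1) / (2 * real (card A))) * (iexp t - 1)))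
    \<le> real k * (2 * \<bar>t\<bar> * (real n * quadratic_error + (real n)\<^sup>2 * cubic_error)
      + exp (2 * (real n / real (card A))) * (2 * (real n / real (card A)))\<^sup>2)"
    (is "_ \<le> real k * ?R")
  using assms
proof (induction k)
  case 0
  then show ?case by (simp add: char_coincidences_def)
next
  case (Suc k)
  define e where "e j = exp (of_real (real j * (real j - 1) / (2 * real (card A))) * (iexp t - 1))" for j :: nat
  define z where "z = of_real (real k / real (card A)) * (iexp t - 1)"
  have "e (Suc k) = exp z * e k"
  proof -
    have "real (Suc k) * (real (Suc k) - 1) / (2 * real (card A))
      = real k / real (card A) + real k * (real k - 1) / (2 * real (card A))"
      using card_A_pos by (simp add: divide_simps del: card_gt_0_iff) (simp add: algebra_simps)
    then show ?thesis
      unfolding e_def z_def exp_add[symmetric] distrib_right[symmetric] of_real_add[symmetric] by simp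
  qed
  then have "char_coincidences (Suc k) t - e (Suc k)
    = (char_coincidences (Suc k) t - exp z * char_coincidences k t) + exp z * (char_coincidences k t - e k)"
    by (simp add: algebra_simps)
  also have "norm \<dots> \<le> ?R + real k * ?R"
  proof (intro norm_triangle_mono)
    \<comment> \<open>The real part of iexp t - 1 is cos t - 1, hence nonpositive.\<close>
    have "Re z \<le> 0"
      unfolding z_def by (auto simp: Re_exp intro!: divide_nonpos_nonneg mult_nonneg_nonpos)
    then have "norm (exp z) \<le> 1" by (simp add: norm_exp_eq_Re)
    then have "norm (exp z * (char_coincidences k t - e k)) \<le> 1 * norm (char_coincidences k t - e k)"
      unfolding norm_mult by (intro mult_right_mono) auto
    also have "\<dots> \<le> real k * ?R" using Suc by (simp add: e_def)
    finally show "norm (exp z * (char_coincidences k t - e k)) \<le> real k * ?R" .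
    have nonneg: "quadratic_error \<ge> 0" "cubic_error \<ge> 0"
      by (auto simp: quadratic_error_def cubic_error_def p_nonneg intro!: sum_nonneg)
    have kn: "real k \<le> real n" "real k / real (card A) \<le> real n / real (card A)"
      using Suc.prems by (auto intro!: divide_right_mono)
    have "2 * \<bar>t\<bar> * (real k * quadratic_error + (real k)\<^sup>2 * cubic_error)
      + exp (2 * (real k / real (card A))) * (2 * (real k / real (card A)))\<^sup>2 \<le> ?R"
      using nonneg kn by (intro add_mono mult_mono power_mono) auto
    with char_coincidences_step[of k t]
    show "norm (char_coincidences (Suc k) t - exp z * char_coincidences k t) \<le> ?R"
      unfolding z_def by linarith
  qed
  finally show ?case by (simp add: e_def algebra_simps)
qed

section \<open>Error terms bounded by the variance of the weights\<close>

text \<open>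
  Cells violating the first alternative carry total mass at most \<open>4 * weight_variance\<close>. This makes up for the
  lack of a uniform upper bound on \<open>p\<close>.
\<close>

lemma p_cases:
  assumes "i \<in> A"
  shows "p i \<le> 2 / real (card A) \<or> p i \<le> 4 * (p i * (weight i - 1)\<^sup>2) \<and> weight i < 1"
proof (cases "weight i \<ge> 1 / 2")
  case True
  \<comment> \<open>As p(i) W(i) = 1 / card A, a lower bound on the weight is an upper bound on
    p(i).\<close>
  then have "p i * (1 / 2) \<le> p i * weight i" using assms p_nonneg by (intro mult_left_mono)
  then show ?thesis using p_weight[OF assms] by simp
next
  case False
  \<comment> \<open>A weight below 1 / 2 lies more than 1 / 2 away from its mean, as in Chebyshev's
    inequality; this gives the factor 4.\<close>
  then have "(1 / 2)\<^sup>2 \<le> (1 - weight i)\<^sup>2" by (intro power_mono) auto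
  then have "p i * (1 / 4) \<le> p i * (1 - weight i)\<^sup>2"
    using assms p_nonneg by (intro mult_left_mono) (auto simp: power2_eq_square)
  then show ?thesis using False by (simp add: power2_commute)
qed

lemma large_p_le:
  assumes "i \<in> A" "p i \<le> 4 * (p i * (weight i - 1)\<^sup>2)"
  shows "p i \<le> 4 * weight_variance"
proof -
  have "p i * (weight i - 1)\<^sup>2 \<le> weight_variance"
    unfolding weight_variance_def using assms(1) by (intro member_le_sum) (auto simp: p_nonneg)
  with assms(2) show ?thesis by simp
qed

text \<open>For a sample of size one, \<open>expect\<close> is the sum against p, and the bound is
  Cauchy-Schwarz.\<close>

lemma sum_p_abs_weight_le: "(\<Sum>i\<in>A. p i * \<bar>weight i - 1\<bar>) \<le> sqrt weight_variance"
  using expect_abs_le[of "Suc 0" "\<lambda>x. weight (x (Suc 0)) - 1"]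
  by (simp add: expect_Suc weight_variance_def)

text \<open>In a cell of moderate size one factor p(i) is at most 2 / card A. In a large cell, 16 =
  4 * 4 arises from bounding one factor p(i) by \<open>4 * weight_variance\<close> and the other by
  its variance summand, while |W - 1| is at most 1. Every cell is charged both bounds, which avoids
  splitting the sum.\<close>

lemma quadratic_error_le:
  "quadratic_error \<le> 2 / real (card A) * sqrt weight_variance + 16 * weight_variance\<^sup>2"
proof -
  have "(p i)\<^sup>2 * \<bar>weight i - 1\<bar>
    \<le> 2 / real (card A) * (p i * \<bar>weight i - 1\<bar>) + 16 * weight_variance * (p i * (weight i - 1)\<^sup>2)"
    if i: "i \<in> A" for i
    using p_cases[OF i]
  proof (elim disjE conjE)
    assume "p i \<le> 2 / real (card A)"
    then have "p i * (p i * \<bar>weight i - 1\<bar>) \<le> 2 / real (card A) * (p i * \<bar>weight i - 1\<bar>)"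
      using p_nonneg[OF i] by (intro mult_right_mono) auto
    moreover have "0 \<le> 16 * weight_variance * (p i * (weight i - 1)\<^sup>2)"
      using p_nonneg[OF i] weight_variance_nonneg by simp
    ultimately show ?thesis by (simp add: power2_eq_square ac_simps)
  next
    assume large: "p i \<le> 4 * (p i * (weight i - 1)\<^sup>2)" and "weight i < 1"
    then have w: "\<bar>weight i - 1\<bar> \<le> 1" using weight_pos[OF i] by simp
    have "p i * p i \<le> (4 * weight_variance) * (4 * (p i * (weight i - 1)\<^sup>2))"
      using large large_p_le[OF i large] p_nonneg[OF i] weight_variance_nonneg by (intro mult_mono) auto
    moreover have "(p i)\<^sup>2 * \<bar>weight i - 1\<bar> \<le> (p i)\<^sup>2 * 1"
      using w by (intro mult_left_mono) auto
    moreover have "0 \<le> 2 / real (card A) * (p i * \<bar>weight i - 1\<bar>)"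
      using p_nonneg[OF i] by simp
    ultimately show ?thesis by (simp add: power2_eq_square)
  qed
  then have "quadratic_error \<le> (\<Sum>i\<in>A. 2 / real (card A) * (p i * \<bar>weight i - 1\<bar>)
      + 16 * weight_variance * (p i * (weight i - 1)\<^sup>2))"
    unfolding quadratic_error_def by (rule sum_mono)
  also have "\<dots> = 2 / real (card A) * (\<Sum>i\<in>A. p i * \<bar>weight i - 1\<bar>) + 16 * weight_variance * weight_variance"
    unfolding weight_variance_def sum.distrib sum_distrib_left[symmetric] ..
  also have "\<dots> \<le> 2 / real (card A) * sqrt weight_variance + 16 * weight_variance * weight_variance"
    by (intro add_right_mono mult_left_mono sum_p_abs_weight_le) simp
  finally show ?thesis by (simp add: power2_eq_square)
qed

text \<open>The same case distinction with two factors bounded uniformly: 4 = 2^2 for moderate cells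
  and 64 = 4^2 * 4 for large ones.\<close>

lemma cubic_error_le: "cubic_error \<le> 4 / (real (card A))\<^sup>2 + 64 * weight_variance ^ 3"
proof -
  have "p i ^ 3 \<le> p i * (4 / (real (card A))\<^sup>2) + 64 * weight_variance\<^sup>2 * (p i * (weight i - 1)\<^sup>2)"
    if i: "i \<in> A" for i
    using p_cases[OF i]
  proof (elim disjE conjE)
    assume "p i \<le> 2 / real (card A)"
    then have "(p i)\<^sup>2 \<le> (2 / real (card A))\<^sup>2" using p_nonneg[OF i] by (intro power_mono)
    then have "p i * (p i)\<^sup>2 \<le> p i * (4 / (real (card A))\<^sup>2)"
      using p_nonneg[OF i] by (intro mult_left_mono) (auto simp: power_divide)
    moreover have "0 \<le> 64 * weight_variance\<^sup>2 * (p i * (weight i - 1)\<^sup>2)"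
      using p_nonneg[OF i] by simp
    ultimately show ?thesis by (simp add: power3_eq_cube power2_eq_square ac_simps)
  next
    assume large: "p i \<le> 4 * (p i * (weight i - 1)\<^sup>2)"
    from large_p_le[OF i this] have "(p i)\<^sup>2 \<le> (4 * weight_variance)\<^sup>2"
      using p_nonneg[OF i] by (intro power_mono)
    then have "(p i)\<^sup>2 * p i \<le> (4 * weight_variance)\<^sup>2 * (4 * (p i * (weight i - 1)\<^sup>2))"
      using p_nonneg[OF i] large by (intro mult_mono) auto
    moreover have "0 \<le> p i * (4 / (real (card A))\<^sup>2)"
      using p_nonneg[OF i] by simp
    ultimately show ?thesis by (simp add: power3_eq_cube power2_eq_square)
  qed
  then have "cubic_error \<le> (\<Sum>i\<in>A. p i * (4 / (real (card A))\<^sup>2)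
      + 64 * weight_variance\<^sup>2 * (p i * (weight i - 1)\<^sup>2))"
    unfolding cubic_error_def by (rule sum_mono)
  also have "\<dots> = 4 / (real (card A))\<^sup>2 + 64 * weight_variance\<^sup>2 * weight_variance"
    unfolding weight_variance_def sum.distrib sum_distrib_left[symmetric] sum_distrib_right[symmetric] sum_p
    by simp
  finally show ?thesis by (simp add: power3_eq_cube power2_eq_square)
qed

text \<open>\<open>iexp\<close> is 1-Lipschitz on the reals, so dropping the centred weight sum
  costs at most |s a| times its first absolute moment, which its second moment controls.\<close>

lemma norm_expect_iexp_minus_char_coincidences_le:
  fixes s a c d :: real and n :: nat
  shows "norm (expect n (\<lambda>x. iexp (s * (a * (\<Sum>j=1..n. weight (x j) - 1) + c * weighted_coincidences weight n x - d)))
      - iexp (- (s * d)) * char_coincidences n (s * c)) \<le> \<bar>s\<bar> * \<bar>a\<bar> * sqrt (real n * weight_variance)"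
proof -
  let ?D = "\<lambda>x. \<Sum>j=1..n. weight (x j) - 1" and ?Y = "\<lambda>x. weighted_coincidences weight n x"
  have "iexp (- (s * d)) * char_coincidences n (s * c) = expect n (\<lambda>x. iexp (s * (c * ?Y x - d)))"
    unfolding char_coincidences_def expect_mult_left[symmetric] exp_add[symmetric] distrib_left[symmetric] of_real_add[symmetric]
    by (simp add: algebra_simps)
  then have "norm (expect n (\<lambda>x. iexp (s * (a * ?D x + c * ?Y x - d)))
      - iexp (- (s * d)) * char_coincidences n (s * c))
    = norm (expect n (\<lambda>x. iexp (s * (a * ?D x + c * ?Y x - d)) - iexp (s * (c * ?Y x - d))))"
    by (simp only: expect_diff)
  also have "\<dots> \<le> expect n (\<lambda>x. norm (iexp (s * (a * ?D x + c * ?Y x - d)) - iexp (s * (c * ?Y x - d))))"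
    by (rule norm_expect_le)
  also have "\<dots> \<le> expect n (\<lambda>x. \<bar>s\<bar> * \<bar>a\<bar> * \<bar>?D x\<bar>)"
  proof (rule expect_mono)
    fix x :: "nat \<Rightarrow> 'a"
    have "norm (iexp (s * (a * ?D x + c * ?Y x - d)) - iexp (s * (c * ?Y x - d)))
      \<le> \<bar>s * (a * ?D x + c * ?Y x - d) - s * (c * ?Y x - d)\<bar>"
      by (rule norm_iexp_diff_le)
    also have "s * (a * ?D x + c * ?Y x - d) - s * (c * ?Y x - d) = s * a * ?D x"
      by (simp add: algebra_simps)
    finally show "norm (iexp (s * (a * ?D x + c * ?Y x - d)) - iexp (s * (c * ?Y x - d))) \<le> \<bar>s\<bar> * \<bar>a\<bar> * \<bar>?D x\<bar>"
      by (simp only: abs_mult)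
  qed
  also have "\<dots> = \<bar>s\<bar> * \<bar>a\<bar> * expect n (\<lambda>x. \<bar>?D x\<bar>)"
    by (rule expect_mult_left)
  also have "\<dots> \<le> \<bar>s\<bar> * \<bar>a\<bar> * sqrt (real n * weight_variance)"
    using expect_abs_le[of n ?D] unfolding expect_sum_weight_square by (intro mult_left_mono) auto
  finally show ?thesis .
qed

text \<open>An explicit bound at fixed sample size: the comparison term is the characteristic
  function at s of c Y - d with Y Poisson of mean n (n - 1) / (2 card A).\<close>

lemma norm_expect_iexp_minus_poisson_le:
  fixes s a c d :: real and n :: nat
  defines "\<mu> \<equiv> real (card A)" and "v \<equiv> weight_variance"
  shows "norm (expect n (\<lambda>x. iexp (s * (a * (\<Sum>j=1..n. weight (x j) - 1) + c * weighted_coincidences weight n x - d)))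
      - iexp (- (s * d)) * exp (of_real (real n * (real n - 1) / (2 * \<mu>)) * (iexp (s * c) - 1)))
    \<le> \<bar>s\<bar> * \<bar>a\<bar> * sqrt (real n * v)
      + real n * (2 * \<bar>s * c\<bar> * (real n * (2 / \<mu> * sqrt v + 16 * v\<^sup>2) + (real n)\<^sup>2 * (4 / \<mu>\<^sup>2 + 64 * v ^ 3))
        + exp (2 * (real n / \<mu>)) * (2 * (real n / \<mu>))\<^sup>2)"
    (is "norm (?E - ?i * ?e) \<le> ?R1 + ?R2")
proof -
  have "norm (char_coincidences n (s * c) - ?e) \<le> real n * (2 * \<bar>s * c\<bar> * (real n * quadratic_error + (real n)\<^sup>2 * cubic_error)
      + exp (2 * (real n / \<mu>)) * (2 * (real n / \<mu>))\<^sup>2)"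
    unfolding \<mu>_def by (rule char_coincidences_bound) simp
  also have "\<dots> \<le> ?R2"
    using quadratic_error_le cubic_error_le unfolding \<mu>_def v_def
    by (intro mult_left_mono add_mono order_refl) auto
  finally have 2: "norm (?i * (char_coincidences n (s * c) - ?e)) \<le> ?R2"
    by (simp only: norm_mult norm_exp_i_times mult_1_left)
  have 1: "norm (?E - ?i * char_coincidences n (s * c)) \<le> ?R1"
    unfolding v_def by (rule norm_expect_iexp_minus_char_coincidences_le)
  have "?E - ?i * ?e = (?E - ?i * char_coincidences n (s * c)) + ?i * (char_coincidences n (s * c) - ?e)"
    by (simp only: right_diff_distrib) simp
  then show ?thesis
    using norm_triangle_mono[OF 1 2] by (simp only:)
qed

end

subsection \<open>Transfer to probability spaces and the limit\<close>

text \<open>Only the events V = b have to be measurable. Hence V may be a whole sample, without a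
  sigma-algebra on the function space.\<close>

lemma (in prob_space) expectation_finite_range:
  fixes g :: "'b \<Rightarrow> 'c::{banach, second_countable_topology}"
  assumes "finite B" "\<And>\<omega>. \<omega> \<in> space M \<Longrightarrow> V \<omega> \<in> B"
    and events: "\<And>b. b \<in> B \<Longrightarrow> {\<omega> \<in> space M. V \<omega> = b} \<in> events"
  shows "expectation (\<lambda>\<omega>. g (V \<omega>)) = (\<Sum>b\<in>B. prob {\<omega> \<in> space M. V \<omega> = b} *\<^sub>R g b)"
proof -
  have "expectation (\<lambda>\<omega>. g (V \<omega>))
    = expectation (\<lambda>\<omega>. \<Sum>b\<in>B. indicator {\<omega> \<in> space M. V \<omega> = b} \<omega> *\<^sub>R g b)"
    using assms(1,2) by (intro Bochner_Integration.integral_cong) (auto simp: indicator_def of_bool_def if_distrib[of "\<lambda>u. u *\<^sub>R _"] cong: if_cong)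
  also have "\<dots> = (\<Sum>b\<in>B. expectation (\<lambda>\<omega>. indicator {\<omega> \<in> space M. V \<omega> = b} \<omega> *\<^sub>R g b))"
    using events by (intro Bochner_Integration.integral_sum) (auto intro!: integrable_scaleR_left simp: integrable_indicator_iff emeasure_eq_measure)
  also have "\<dots> = (\<Sum>b\<in>B. prob {\<omega> \<in> space M. V \<omega> = b} *\<^sub>R g b)"
  proof (intro sum.cong refl)
    fix b assume "b \<in> B"
    from events[OF this] have int: "integrable M (indicator {\<omega> \<in> space M. V \<omega> = b} :: _ \<Rightarrow> real)"
      by (simp add: integrable_indicator_iff emeasure_eq_measure)
    have "{\<omega> \<in> space M. V \<omega> = b} \<inter> space M = {\<omega> \<in> space M. V \<omega> = b}" by auto
    with int show "expectation (\<lambda>\<omega>. indicator {\<omega> \<in> space M. V \<omega> = b} \<omega> *\<^sub>R g b)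
      = prob {\<omega> \<in> space M. V \<omega> = b} *\<^sub>R g b"
      by (simp only: integral_scaleR_left Bochner_Integration.integral_indicator)
  qed
  finally show ?thesis .
qed

text \<open>Independence turns the probability of each sample into a product of cell probabilities.
  As g sees only the coordinates 1, ..., n, the sample may be restricted to them, which makes it an
  element of the extensional product.\<close>

lemma (in prob_space) expectation_sample:
  fixes g :: "(nat \<Rightarrow> 'b) \<Rightarrow> 'c::{banach, second_countable_topology}"
  assumes "finite_sampling A p" and n: "n \<ge> 1"
    and indep: "indep_vars (\<lambda>_. count_space A) S {1..n}"
    and S: "\<And>k i. k \<in> {1..n} \<Longrightarrow> i \<in> A \<Longrightarrow> prob {\<omega> \<in> space M. S k \<omega> = i} = p i"
    and g: "\<And>x y. (\<And>k. k \<in> {1..n} \<Longrightarrow> x k = y k) \<Longrightarrow> g x = g y"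
  shows "expectation (\<lambda>\<omega>. g (\<lambda>k. S k \<omega>)) = finite_sampling.expect A p n g"
proof -
  interpret finite_sampling A p by fact
  let ?V = "\<lambda>\<omega>. restrict (\<lambda>k. S k \<omega>) {1..n}"
  have rv: "S k \<in> measurable M (count_space A)" if "k \<in> {1..n}" for k
    using indep that by (auto simp: indep_vars_def)
  have eq: "{\<omega> \<in> space M. ?V \<omega> = x} = (\<Inter>k\<in>{1..n}. S k -` {x k} \<inter> space M)"
    if "x \<in> {1..n} \<rightarrow>\<^sub>E A" for x
  proof -
    have "?V \<omega> = x \<longleftrightarrow> (\<forall>k\<in>{1..n}. S k \<omega> = x k)" for \<omega>
      using that by (auto simp: fun_eq_iff PiE_def extensional_def restrict_def)
    then show ?thesis using n by auto
  qed
  have sets: "S k -` {x k} \<inter> space M \<in> events" if "x \<in> {1..n} \<rightarrow>\<^sub>E A" "k \<in> {1..n}" for x k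
    using that PiE_mem[OF that] by (intro measurable_sets[OF rv]) auto
  have "expectation (\<lambda>\<omega>. g (\<lambda>k. S k \<omega>)) = expectation (\<lambda>\<omega>. g (?V \<omega>))"
    by (intro Bochner_Integration.integral_cong refl g) simp
  also have "\<dots> = (\<Sum>x\<in>{1..n} \<rightarrow>\<^sub>E A. prob {\<omega> \<in> space M. ?V \<omega> = x} *\<^sub>R g x)"
  proof (rule expectation_finite_range)
    show "?V \<omega> \<in> {1..n} \<rightarrow>\<^sub>E A" if "\<omega> \<in> space M" for \<omega>
      using measurable_space[OF rv that] by auto
    show "{\<omega> \<in> space M. ?V \<omega> = x} \<in> events" if "x \<in> {1..n} \<rightarrow>\<^sub>E A" for x
      unfolding eq[OF that] using n by (intro sets.finite_INT sets that) auto
  qed (rule finite_samples)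
  also have "\<dots> = expect n g"
    unfolding expect_def
  proof (intro sum.cong refl arg_cong2[where f = scaleR])
    fix x assume x: "x \<in> {1..n} \<rightarrow>\<^sub>E A"
    have "prob {\<omega> \<in> space M. ?V \<omega> = x} = (\<Prod>k\<in>{1..n}. prob (S k -` {x k} \<inter> space M))"
      unfolding eq[OF x] using n PiE_mem[OF x] by (intro indep_varsD[OF indep]) auto
    also have "\<dots> = (\<Prod>k=1..n. p (x k))"
    proof (rule prod.cong)
      fix k assume k: "k \<in> {1..n}"
      have "S k -` {x k} \<inter> space M = {\<omega> \<in> space M. S k \<omega> = x k}" by auto
      with S[OF k PiE_mem[OF x k]] show "prob (S k -` {x k} \<inter> space M) = p (x k)" by simp
    qed simp
    finally show "prob {\<omega> \<in> space M. ?V \<omega> = x} = (\<Prod>k=1..n. p (x k))" .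
  qed
  finally show ?thesis .
qed

text \<open>Summing against the Poisson weights gives the exponential series at \<open>u\<close>,
  apart from a phase and the factor exp (- rate).\<close>

lemma char_affine_poisson:
  fixes a b rate t :: real
  assumes "prob_space Q" and Z: "Z \<in> measurable Q (count_space UNIV)"
    and rate: "rate > 0"
    and distr: "distr Q (count_space UNIV) Z = measure_pmf (poisson_pmf rate)"
  shows "char (distr Q borel (\<lambda>\<omega>. a * real (Z \<omega>) - b)) t
    = iexp (- (t * b)) * exp (of_real rate * (iexp (t * a) - 1))"
proof -
  have [measurable]: "Z \<in> measurable Q (count_space UNIV)" by fact
  let ?f = "\<lambda>k. iexp (t * (a * real k - b))"
  define u where "u = of_real rate * iexp (t * a)"
  have "char (distr Q borel (\<lambda>\<omega>. a * real (Z \<omega>) - b)) t = (LINT \<omega>|Q. ?f (Z \<omega>))"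
    unfolding char_def by (subst integral_distr) auto
  also have "\<dots> = (LINT k|distr Q (count_space UNIV) Z. ?f k)"
    by (subst integral_distr) auto
  also have "\<dots> = (LINT k|count_space UNIV. pmf (poisson_pmf rate) k *\<^sub>R ?f k)"
    unfolding distr measure_pmf_eq_density by (subst integral_density) auto
  also have "\<dots> = iexp (- (t * b)) * of_real (exp (- rate)) * exp u"
  proof -
    have f: "pmf (poisson_pmf rate) k *\<^sub>R ?f k = iexp (- (t * b)) * of_real (exp (- rate)) * (u ^ k /\<^sub>R fact k)" for k
    proof -
      have "?f k = iexp (- (t * b)) * iexp (t * a) ^ k"
        by (simp add: exp_of_nat_mult[symmetric] exp_add[symmetric] algebra_simps)
      then show ?thesis
        using rate by (simp add: u_def power_mult_distrib scaleR_conv_of_real field_simps)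
    qed
    have int: "integrable (count_space UNIV) (\<lambda>k. pmf (poisson_pmf rate) k *\<^sub>R ?f k)"
      unfolding f integrable_count_space_nat_iff norm_mult using summable_norm_exp[of u] by (rule summable_mult)
    have "(\<lambda>k. pmf (poisson_pmf rate) k *\<^sub>R ?f k) sums (iexp (- (t * b)) * of_real (exp (- rate)) * exp u)"
      unfolding f by (intro sums_mult exp_converges)
    with sums_integral_count_space_nat[OF int] show ?thesis by (rule sums_unique2)
  qed
  also have "\<dots> = iexp (- (t * b)) * exp (of_real rate * (iexp (t * a) - 1))"
    unfolding u_def by (simp add: exp_of_real[symmetric] exp_add[symmetric] algebra_simps)
  finally show ?thesis .
qed

text \<open>Everything is expressed through r = n / sqrt m, 1 / n and n v, whose limits are known:
  n^2 / m is r^2 and n^3 / m^2 is r^4 / n. This absorbs the leading factor n.\<close>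

lemma poisson_error_tendsto_0:
  fixes m :: "nat \<Rightarrow> nat" and v t :: "nat \<Rightarrow> real"
  assumes m: "\<And>n. n \<ge> 1 \<Longrightarrow> m n > 0"
    and ratio: "(\<lambda>n. real n / sqrt (real (m n))) \<longlonglongrightarrow> lam"
    and v: "(\<lambda>n. real n * v n) \<longlonglongrightarrow> 0"
    and t: "t \<longlonglongrightarrow> \<tau>"
  shows "(\<lambda>n. real n * (2 * \<bar>t n\<bar> * (real n * (2 / real (m n) * sqrt (v n) + 16 * (v n)\<^sup>2)
        + (real n)\<^sup>2 * (4 / (real (m n))\<^sup>2 + 64 * v n ^ 3))
      + exp (2 * (real n / real (m n))) * (2 * (real n / real (m n)))\<^sup>2)) \<longlonglongrightarrow> 0"
    (is "?f \<longlonglongrightarrow> 0")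
proof -
  define r where "r n = real n / sqrt (real (m n))" for n
  define g where "g n = 2 * \<bar>t n\<bar> * (2 * (r n)\<^sup>2 * sqrt (inverse (real n) * (real n * v n)) + 16 * (real n * v n)\<^sup>2
        + 4 * (r n) ^ 4 * inverse (real n) + 64 * (real n * v n) ^ 3)
      + exp (2 * ((r n)\<^sup>2 * inverse (real n))) * (4 * (r n) ^ 4 * inverse (real n))" for n
  have "g \<longlonglongrightarrow> 2 * \<bar>\<tau>\<bar> * (2 * lam\<^sup>2 * sqrt (0 * 0) + 16 * 0\<^sup>2 + 4 * lam ^ 4 * 0 + 64 * 0 ^ 3)
      + exp (2 * (lam\<^sup>2 * 0)) * (4 * lam ^ 4 * 0)"
    unfolding g_def by (intro tendsto_intros v t lim_inverse_n ratio[folded r_def])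
  then have "g \<longlonglongrightarrow> 0" by simp
  moreover have "g n = ?f n" if "n \<ge> 1" for n
  proof -
    have n: "real n > 0" and \<mu>: "real (m n) > 0" using that m[OF that] by auto
    have r: "(r n)\<^sup>2 = (real n)\<^sup>2 / real (m n)" by (simp add: r_def power_divide)
    then have r4: "(r n) ^ 4 = ((real n)\<^sup>2 / real (m n))\<^sup>2"
      by (metis power_even_eq numeral_Bit0 mult_2)
    have arg: "inverse (real n) * (real n * v n) = v n"
      "(real n)\<^sup>2 / real (m n) * inverse (real n) = real n / real (m n)"
      using n \<mu> by (simp_all add: field_simps power2_eq_square)
    have "N * (T * (N * (2 / \<mu> * \<sigma> + 16 * w\<^sup>2) + N\<^sup>2 * (4 / \<mu>\<^sup>2 + 64 * w ^ 3)) + e * (2 * (N / \<mu>))\<^sup>2)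
      = T * (2 * (N\<^sup>2 / \<mu>) * \<sigma> + 16 * (N * w)\<^sup>2 + 4 * (N\<^sup>2 / \<mu>)\<^sup>2 * inverse N + 64 * (N * w) ^ 3)
        + e * (4 * (N\<^sup>2 / \<mu>)\<^sup>2 * inverse N)" if "N > 0" "\<mu> > 0" for N T \<mu> \<sigma> w e :: real
    proof -
      have expand: "N * (T * (N * (a + 16 * w\<^sup>2) + N\<^sup>2 * (b + 64 * w ^ 3)) + e * c)
        = T * (N * N * a + 16 * (N * w)\<^sup>2 + N * N\<^sup>2 * b + 64 * (N * w) ^ 3) + e * (N * c)" for a b c :: real
        by (simp add: algebra_simps power2_eq_square power3_eq_cube)
      have 1: "4 * (N\<^sup>2 / \<mu>)\<^sup>2 * inverse N = N * (2 * (N / \<mu>))\<^sup>2"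
        using that by (simp add: field_simps power2_eq_square)
      have 2: "N * N\<^sup>2 * (4 / \<mu>\<^sup>2) = N * (2 * (N / \<mu>))\<^sup>2"
        using that by (simp add: field_simps power2_eq_square)
      have 3: "2 * (N\<^sup>2 / \<mu>) * \<sigma> = N * N * (2 / \<mu> * \<sigma>)"
        by (simp add: power2_eq_square)
      show ?thesis
        unfolding expand 1 2 3 ..
    qed
    from this[OF n \<mu>] show ?thesis
      unfolding g_def r r4 arg by metis
  qed
  then have "eventually (\<lambda>n. g n = ?f n) sequentially"
    by (rule eventually_sequentiallyI)
  ultimately show ?thesis
    by (rule Lim_transform_eventually)
qed

lemma vimage_singleton_Int: "f -` {i} \<inter> A = {x \<in> A. f x = i}"
  by auto

section \<open>Convergence in distribution of the normalised statistic\<close>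

theorem theorem2p1:
  fixes m :: "nat \<Rightarrow> nat"
    and p :: "nat \<Rightarrow> nat \<Rightarrow> real"
    and N :: "nat \<Rightarrow> 'a measure" and X :: "nat \<Rightarrow> 'a \<Rightarrow> nat"
    and M :: "nat \<Rightarrow> 'b measure" and S :: "nat \<Rightarrow> nat \<Rightarrow> 'b \<Rightarrow> nat"
    and Q :: "'c measure" and Z :: "'c \<Rightarrow> nat"
    and lam :: real
  assumes m_pos: "\<And>n. n \<ge> 1 \<Longrightarrow> m n > 0"
    and m_at_top: "filterlim m at_top sequentially"
    and N_prob: "\<And>n. n \<ge> 1 \<Longrightarrow> prob_space (N n)"
    and X_rv: "\<And>n. n \<ge> 1 \<Longrightarrow> X n \<in> measurable (N n) (count_space {1..m n})"
    and X_prob: "\<And>n i. n \<ge> 1 \<Longrightarrow> i \<in> {1..m n} \<Longrightarrow> measure (N n) {\<omega> \<in> space (N n). X n \<omega> = i} = p n i"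
    and p_pos: "\<And>n i. n \<ge> 1 \<Longrightarrow> i \<in> {1..m n} \<Longrightarrow> p n i > 0"
    and M_prob: "\<And>n. n \<ge> 1 \<Longrightarrow> prob_space (M n)"
    and S_indep: "\<And>n. n \<ge> 1 \<Longrightarrow> prob_space.indep_vars (M n) (\<lambda>_. count_space {1..m n}) (S n) {1..n}"
    and S_distr: "\<And>n k. n \<ge> 1 \<Longrightarrow> k \<in> {1..n} \<Longrightarrow>
          distr (M n) (count_space {1..m n}) (S n k) = distr (N n) (count_space {1..m n}) (X n)"
    and var_lim: "(\<lambda>n. 1 / (real (m n) * real n) * prob_space.variance (N n) (\<lambda>\<omega>. 1 / p n (X n \<omega>)))
          \<longlonglongrightarrow> 0"
    and lam_pos: "lam > 0"
    and ratio_lim: "(\<lambda>n. real n / sqrt (real (m n))) \<longlonglongrightarrow> lam"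
    and Q_prob: "prob_space Q"
    and Z_rv: "Z \<in> measurable Q (count_space UNIV)"
    and Z_poisson: "distr Q (count_space UNIV) Z = measure_pmf (poisson_pmf (lam\<^sup>2 / 2))"
  shows "weak_conv_m
      (\<lambda>n. distr (M n) borel
        (\<lambda>\<omega>. (pearson_chi_square n (m n) (p n) (\<lambda>k. S n k \<omega>) - real (m n)) / sqrt (2 * real (m n))))
      (distr Q borel (\<lambda>\<omega>. sqrt 2 / lam * real (Z \<omega>) - lam / sqrt 2))"
proof -
  define stat where "stat n x = (pearson_chi_square n (m n) (p n) x - real (m n)) / sqrt (2 * real (m n))" for n x
  define r where "r n = real n / sqrt (real (m n))" for n
  define v where "v n = finite_sampling.weight_variance {1..m n} (p n)" for n
  define D where "D n = distr (M n) borel (\<lambda>\<omega>. stat n (\<lambda>k. S n k \<omega>))" for n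
  define E where "E = distr Q borel (\<lambda>\<omega>. sqrt 2 / lam * real (Z \<omega>) - lam / sqrt 2)"

  have X_event: "{\<omega> \<in> space (N n). X n \<omega> = i} \<in> sets (N n)" if "n \<ge> 1" "i \<in> {1..m n}" for n i
    unfolding vimage_singleton_Int[symmetric] using that(2) by (intro measurable_sets[OF X_rv[OF that(1)]]) auto
  have X_expectation: "integral\<^sup>L (N n) (\<lambda>\<omega>. g (X n \<omega>)) = (\<Sum>i=1..m n. p n i * g i)"
    if n: "n \<ge> 1" for n and g :: "nat \<Rightarrow> real"
  proof -
    interpret N: prob_space "N n" using n by (rule N_prob)
    have "integral\<^sup>L (N n) (\<lambda>\<omega>. g (X n \<omega>))
      = (\<Sum>i\<in>{1..m n}. measure (N n) {\<omega> \<in> space (N n). X n \<omega> = i} *\<^sub>R g i)"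
      using measurable_space[OF X_rv[OF n]] X_event[OF n] by (intro N.expectation_finite_range) auto
    then show ?thesis using X_prob[OF n] by simp
  qed
  \<comment> \<open>That the cell probabilities add up to 1 is read off from the expectation of the
    constant 1, since \<open>X n\<close> takes values in \<open>{1..m n}\<close>.\<close>
  have sampling: "finite_sampling {1..m n} (p n)" if n: "n \<ge> 1" for n
  proof
    interpret N: prob_space "N n" using n by (rule N_prob)
    show "(\<Sum>i\<in>{1..m n}. p n i) = 1"
      using X_expectation[OF n, of "\<lambda>_. 1"] by (simp add: N.prob_space)
  qed (use p_pos[OF n] in auto)
  have S_prob: "measure (M n) {\<omega> \<in> space (M n). S n k \<omega> = i} = p n i"
    if n: "n \<ge> 1" and k: "k \<in> {1..n}" and i: "i \<in> {1..m n}" for n k i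
  proof -
    interpret M: prob_space "M n" using n by (rule M_prob)
    have S: "S n k \<in> measurable (M n) (count_space {1..m n})"
      using S_indep[OF n] k by (auto simp: M.indep_vars_def)
    have "measure (M n) {\<omega> \<in> space (M n). S n k \<omega> = i} = measure (distr (M n) (count_space {1..m n}) (S n k)) {i}"
      unfolding vimage_singleton_Int[symmetric] using S i by (intro measure_distr[symmetric]) auto
    also have "\<dots> = measure (N n) {\<omega> \<in> space (N n). X n \<omega> = i}"
      unfolding vimage_singleton_Int[symmetric] S_distr[OF n k] using X_rv[OF n] i by (intro measure_distr) auto
    finally show ?thesis using X_prob[OF n i] by simp
  qed

  \<comment> \<open>The variance of 1 / p(X) is m^2 v, so the hypothesis controls m v / n, and r^2 =
    n^2 / m converts this into n v.\<close>
  have v_variance: "real n * v n = (r n)\<^sup>2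
      * (1 / (real (m n) * real n) * prob_space.variance (N n) (\<lambda>\<omega>. 1 / p n (X n \<omega>)))"
    if n: "n \<ge> 1" for n
  proof -
    interpret finite_sampling "{1..m n}" "p n" using n by (rule sampling)
    have mean: "integral\<^sup>L (N n) (\<lambda>\<omega>. 1 / p n (X n \<omega>)) = real (m n)"
    proof -
      have "(\<Sum>i=1..m n. p n i * (1 / p n i)) = (\<Sum>i=1..m n. 1)"
        using p_pos by (intro sum.cong) (auto simp: less_imp_neq[symmetric])
      then show ?thesis
        using X_expectation[OF n, of "\<lambda>i. 1 / p n i"] by simp
    qed
    have "prob_space.variance (N n) (\<lambda>\<omega>. 1 / p n (X n \<omega>)) = (\<Sum>i=1..m n. p n i * (1 / p n i - real (m n))\<^sup>2)"
      unfolding mean by (rule X_expectation[OF n])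
    also have "\<dots> = (real (m n))\<^sup>2 * v n"
      unfolding v_def weight_variance_def sum_distrib_left
    proof (rule sum.cong)
      fix i assume i: "i \<in> {1..m n}"
      have "1 / p n i - real (m n) = real (m n) * (weight i - 1)"
        unfolding weight_def using m_pos[OF n] p_pos[OF i] by (simp add: field_simps)
      then show "p n i * (1 / p n i - real (m n))\<^sup>2 = (real (m n))\<^sup>2 * (p n i * (weight i - 1)\<^sup>2)"
        by (simp add: power_mult_distrib)
    qed simp
    finally show ?thesis
      using n m_pos[OF n] by (simp add: r_def power_divide field_simps power2_eq_square)
  qed
  have r_lim: "r \<longlonglongrightarrow> lam"
    using ratio_lim by (simp add: r_def[abs_def])
  have v_lim: "(\<lambda>n. real n * v n) \<longlonglongrightarrow> 0"
  proof -
    have "(\<lambda>n. (r n)\<^sup>2 * (1 / (real (m n) * real n) * prob_space.variance (N n) (\<lambda>\<omega>. 1 / p n (X n \<omega>)))) \<longlonglongrightarrow> lam\<^sup>2 * 0"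
      by (intro tendsto_intros r_lim var_lim)
    moreover have "eventually (\<lambda>n. (r n)\<^sup>2 * (1 / (real (m n) * real n) * prob_space.variance (N n) (\<lambda>\<omega>. 1 / p n (X n \<omega>)))
        = real n * v n) sequentially"
      using v_variance[symmetric] by (rule eventually_sequentiallyI)
    ultimately show ?thesis
      unfolding mult_zero_right by (rule Lim_transform_eventually)
  qed

  have stat_cong: "stat n x = stat n y" if "\<And>k. k \<in> {1..n} \<Longrightarrow> x k = y k" for n x y
  proof -
    have "empirical_freq n x i = empirical_freq n y i" for i
      unfolding empirical_freq_def occurrences_def[symmetric] using that
      by (intro arg_cong2[where f = times] refl occurrences_cong)
    then show ?thesis by (simp add: stat_def pearson_chi_square_def)
  qed
  have stat_measurable: "(\<lambda>\<omega>. stat n (\<lambda>k. S n k \<omega>)) \<in> borel_measurable (M n)" if n: "n \<ge> 1" for n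
  proof -
    interpret M: prob_space "M n" using n by (rule M_prob)
    have "(\<lambda>\<omega>. of_bool (S n k \<omega> = i) :: real) \<in> borel_measurable (M n)" if "k \<in> {1..n}" for k i
    proof -
      have "S n k \<in> measurable (M n) (count_space {1..m n})"
        using S_indep[OF n] that by (auto simp: M.indep_vars_def)
      then show ?thesis by (rule measurable_compose) simp
    qed
    then show ?thesis
      unfolding stat_def pearson_chi_square_def empirical_freq_def
      by (intro borel_measurable_divide borel_measurable_diff borel_measurable_times borel_measurable_sum
          borel_measurable_power borel_measurable_const) auto
  qed

  \<comment> \<open>In terms of r the coefficients of
    \<open>pearson_chi_square_decomposition\<close> are 1 / (sqrt 2 r), sqrt 2 / r and r / sqrt 2,
    and the Poisson mean n (n - 1) / (2 m) is (r^2 - r^2 / n) / 2. The limit of the comparison term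
    then follows from that of r.\<close>
  have char_bound: "norm (char (D n) s
      - iexp (- (s * (r n / sqrt 2))) * exp (of_real (((r n)\<^sup>2 - (r n)\<^sup>2 * inverse (real n)) / 2) * (iexp (s * (sqrt 2 / r n)) - 1)))
    \<le> \<bar>s\<bar> * \<bar>1 / (sqrt 2 * r n)\<bar> * sqrt (real n * v n)
      + real n * (2 * \<bar>s * (sqrt 2 / r n)\<bar> * (real n * (2 / real (m n) * sqrt (v n) + 16 * (v n)\<^sup>2)
          + (real n)\<^sup>2 * (4 / (real (m n))\<^sup>2 + 64 * v n ^ 3))
        + exp (2 * (real n / real (m n))) * (2 * (real n / real (m n)))\<^sup>2)"
    if n: "n \<ge> 1" for n s
  proof -
    interpret M: prob_space "M n" using n by (rule M_prob)
    interpret finite_sampling "{1..m n}" "p n" using n by (rule sampling)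
    have "char (D n) s = M.expectation (\<lambda>\<omega>. iexp (s * stat n (\<lambda>k. S n k \<omega>)))"
      unfolding char_def D_def using stat_measurable[OF n] by (subst integral_distr) auto
    also have "\<dots> = expect n (\<lambda>x. iexp (s * stat n x))"
    proof (intro M.expectation_sample sampling n S_indep S_prob)
      show "iexp (s * stat n x) = iexp (s * stat n y)" if "\<And>k. k \<in> {1..n} \<Longrightarrow> x k = y k" for x y
        using stat_cong[OF that] by simp
    qed
    also have "\<dots> = expect n (\<lambda>x. iexp (s * (1 / (sqrt 2 * r n) * (\<Sum>j=1..n. weight (x j) - 1)
        + sqrt 2 / r n * weighted_coincidences weight n x - r n / sqrt 2)))"
    proof (intro expect_cong)
      fix x assume x: "x \<in> {1..n} \<rightarrow>\<^sub>E {1..m n}"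
      have "stat n x = 1 / (sqrt 2 * r n) * (\<Sum>j=1..n. weight (x j) - 1)
        + sqrt 2 / r n * weighted_coincidences weight n x - r n / sqrt 2"
        unfolding stat_def weight_def card_atLeastAtMost diff_Suc_1
        using pearson_chi_square_decomposition[of n "m n" "p n" x] n m_pos[OF n] p_pos sum_p x
        by (simp add: r_def real_sqrt_mult PiE_iff)
      then show "iexp (s * stat n x) = iexp (s * (1 / (sqrt 2 * r n) * (\<Sum>j=1..n. weight (x j) - 1)
        + sqrt 2 / r n * weighted_coincidences weight n x - r n / sqrt 2))"
        by (rule arg_cong)
    qed
    finally have "char (D n) s = \<dots>" .
    moreover have "((r n)\<^sup>2 - (r n)\<^sup>2 * inverse (real n)) / 2 = real n * (real n - 1) / (2 * real (m n))"
      using n m_pos[OF n] by (simp add: r_def power_divide field_simps power2_eq_square)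
    ultimately show ?thesis
      using norm_expect_iexp_minus_poisson_le[of n s "1 / (sqrt 2 * r n)" "sqrt 2 / r n" "r n / sqrt 2"]
      by (simp only: v_def card_atLeastAtMost diff_Suc_1)
  qed

  have char_lim: "(\<lambda>n. char (D n) s) \<longlonglongrightarrow> char E s" for s
  proof -
    define e where "e n = iexp (- (s * (r n / sqrt 2)))
      * exp (of_real (((r n)\<^sup>2 - (r n)\<^sup>2 * inverse (real n)) / 2) * (iexp (s * (sqrt 2 / r n)) - 1))" for n
    have "char E s = iexp (- (s * (lam / sqrt 2))) * exp (of_real (lam\<^sup>2 / 2) * (iexp (s * (sqrt 2 / lam)) - 1))"
      unfolding E_def using lam_pos by (intro char_affine_poisson Q_prob Z_rv Z_poisson) simp
    moreover have "e \<longlonglongrightarrow> iexp (- (s * (lam / sqrt 2)))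
      * exp (of_real ((lam\<^sup>2 - lam\<^sup>2 * 0) / 2) * (iexp (s * (sqrt 2 / lam)) - 1))"
      unfolding e_def using lam_pos by (intro tendsto_intros r_lim lim_inverse_n) auto
    ultimately have e_lim: "e \<longlonglongrightarrow> char E s" by simp
    have "(\<lambda>n. \<bar>s\<bar> * \<bar>1 / (sqrt 2 * r n)\<bar> * sqrt (real n * v n)) \<longlonglongrightarrow> \<bar>s\<bar> * \<bar>1 / (sqrt 2 * lam)\<bar> * sqrt 0"
      using lam_pos by (intro tendsto_intros r_lim v_lim) auto
    then have "(\<lambda>n. \<bar>s\<bar> * \<bar>1 / (sqrt 2 * r n)\<bar> * sqrt (real n * v n)) \<longlonglongrightarrow> 0"
      by simp
    moreover have "(\<lambda>n. s * (sqrt 2 / r n)) \<longlonglongrightarrow> s * (sqrt 2 / lam)"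
      using lam_pos by (intro tendsto_intros r_lim) auto
    from poisson_error_tendsto_0[OF m_pos ratio_lim v_lim this]
    have "(\<lambda>n. real n * (2 * \<bar>s * (sqrt 2 / r n)\<bar> * (real n * (2 / real (m n) * sqrt (v n) + 16 * (v n)\<^sup>2)
          + (real n)\<^sup>2 * (4 / (real (m n))\<^sup>2 + 64 * v n ^ 3))
        + exp (2 * (real n / real (m n))) * (2 * (real n / real (m n)))\<^sup>2)) \<longlonglongrightarrow> 0" .
    ultimately have bound_lim: "(\<lambda>n. \<bar>s\<bar> * \<bar>1 / (sqrt 2 * r n)\<bar> * sqrt (real n * v n)
      + real n * (2 * \<bar>s * (sqrt 2 / r n)\<bar> * (real n * (2 / real (m n) * sqrt (v n) + 16 * (v n)\<^sup>2)
          + (real n)\<^sup>2 * (4 / (real (m n))\<^sup>2 + 64 * v n ^ 3))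
        + exp (2 * (real n / real (m n))) * (2 * (real n / real (m n)))\<^sup>2)) \<longlonglongrightarrow> 0"
      by (rule tendsto_add_zero)
    have "(\<lambda>n. char (D n) s - e n) \<longlonglongrightarrow> 0"
      by (rule Lim_null_comparison[OF _ bound_lim], rule eventually_sequentiallyI[of 1], unfold e_def, rule char_bound)
    from tendsto_add[OF this e_lim] show ?thesis by simp
  qed

  \<comment> \<open>\<open>M n\<close> is known to be a probability space only for n >= 1. Levy's
    theorem is therefore applied to the shifted sequence, and the shift does not affect the
    limit.\<close>
  have "weak_conv_m (\<lambda>n. D (Suc n)) E"
  proof (rule levy_continuity)
    show "real_distribution (D (Suc n))" for n
      unfolding D_def using M_prob[of "Suc n"] stat_measurable[of "Suc n"]
      by (intro prob_space.real_distribution_distr) auto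
    show "real_distribution E"
      unfolding E_def by (intro prob_space.real_distribution_distr Q_prob measurable_compose[OF Z_rv]) simp
    show "(\<lambda>n. char (D (Suc n)) s) \<longlonglongrightarrow> char E s" for s
      using char_lim by (rule LIMSEQ_Suc)
  qed
  then have "weak_conv_m D E"
    unfolding weak_conv_m_def weak_conv_def by (blast intro: LIMSEQ_imp_Suc)
  then show ?thesis
    unfolding D_def E_def stat_def .
qed

end
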